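(* Let $L$ be a completely distributive lattice that is a unital quantale with operation $*$, let $D,D'$ be domains, and let $\phi:D\to\underline{M}_{[L]}D'$ be a mapping. If (a) $\phi$ is Scott continuous, or (b) $*$ is infinitely distributive with respect to infimum, then the mapping $\underline{sp}(\phi):\underline{M}_{[L]}D\to\underline{M}_{[L]}D'$ is linear.
   Context: A domain is a directed complete poset $D$ that is continuous: for each $b\in D$ the set $\{a\in D\mid a\ll b\}$ is directed with supremum $b$, where $a\ll b$ means that for each directed $C\subset D$ with $b\le \sup C$ there is $c\in C$ with $a\le c$. A mapping between posets is Scott continuous if it preserves directed suprema. $L$ has bottom $0$ and top $1$. That $L$ is a unital quantale means: $*:L\times L\to L$ is an associative binary operation (not necessarily commutative), $1$ is a two-sided unit for $*$, and $*$ distributes over arbitrary suprema in each variable. Infinite distributivity of $*$ with respect to infimum means $\alpha*\inf S=\inf\{\alpha*s\mid s\in S\}$ and $(\inf S)*\alpha=\inf\{s*\alpha\mid s\in S\}$ for all $\alpha\in L$ and all nonempty $S\subset L$. $\underline{M}_{[L]}D=[D\to L^{op}]^{op}$ is the set of $L$-fuzzy monotonic predicates on $D$: all functions $m:D\to L$ such that $m:D\to L^{op}$ is Scott continuous, i.e. $m$ is antitone and $m(\sup C)=\inf\{m(c)\mid c\in C\}$ in $L$ for each directed $C\subset D$. It is ordered pointwise as functions to $L$ and is a complete lattice. It carries the operations $\bar\oplus$ (binary join, which is the pointwise join) and $\bar\odot:L\times\underline{M}_{[L]}D\to\underline{M}_{[L]}D$, where $\alpha\mathbin{\bar\odot}m$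 is the least predicate $m'\in\underline{M}_{[L]}D$ with $\alpha*m(b)\le m'(b)$ for all $b\in D$; explicitly $(\alpha\mathbin{\bar\odot}m)(b)=\inf\{\alpha*m(a)\mid a\in D,\ a\ll b\}$. The same notation is used for $D'$. For a mapping $\phi:D\to\underline{M}_{[L]}D'$ and $m\in\underline{M}_{[L]}D$, the strongest postcondition $\underline{sp}(\phi)(m)$ is the least $m'\in\underline{M}_{[L]}D'$ such that $m'(b)\ge m(a)*\phi(a)(b)$ for all $a\in D$, $b\in D'$; explicitly, $$\underline{sp}(\phi)(m)(b)=\inf\bigl\{\sup\{m(a)*\phi(a)(b')\mid a\in D\}\bigm| b'\in D',\ b'\ll b\bigr\},\quad b\in D'.$$ A mapping $f:\underline{M}_{[L]}D\to\underline{M}_{[L]}D'$ is linear if $$f(\alpha_1\mathbin{\bar\odot}x_1\mathbin{\bar\oplus}\dots\mathbin{\bar\oplus}\alpha_n\mathbin{\bar\odot}x_n)=\alpha_1\mathbin{\bar\odot}f(x_1)\mathbin{\bar\oplus}\dots\mathbin{\bar\oplus}\alpha_n\mathbin{\bar\odot}f(x_n)$$ for all $n\ge 1$, $x_1,\dots,x_n\in\underline{M}_{[L]}D$ and $\alpha_1,\dots,\alpha_n\in L$. *)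

theory Defs
  imports "HOL-Library.Lub_Glb"
begin

section \<open>Domains\<close>

definition (in order) directed :: "'a set \<Rightarrow> bool" where
  "directed C \<longleftrightarrow> C \<noteq> {} \<and> (\<forall>x\<in>C. \<forall>y\<in>C. \<exists>z\<in>C. x \<le> z \<and> y \<le> z)"

text \<open>As in \<^class>\<open>ccpo\<close>, \<^const>\<open>Sup\<close> is constrained only where the supremum is
  required to exist.\<close>

class dcpo = order + Sup +
  assumes directed_Sup_upper: "directed C \<Longrightarrow> x \<in> C \<Longrightarrow> x \<le> Sup C"
    and directed_Sup_least: "directed C \<Longrightarrow> (\<And>x. x \<in> C \<Longrightarrow> x \<le> z) \<Longrightarrow> Sup C \<le> z"

definition (in dcpo) way_below :: "'a \<Rightarrow> 'a \<Rightarrow> bool"  (infix \<open>\<lless>\<close> 50) where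
  "a \<lless> b \<longleftrightarrow> (\<forall>C. directed C \<and> b \<le> Sup C \<longrightarrow> (\<exists>c\<in>C. a \<le> c))"

class continuous_domain = dcpo +
  assumes directed_way_below: "directed {a. a \<lless> b}"
    and Sup_way_below: "Sup {a. a \<lless> b} = b"


section \<open>Unital quantales whose unit is the top element\<close>

class unital_quantale = complete_lattice + monoid_mult +
  assumes one_eq_top: "1 = top"
    and mult_Sup: "x * Sup S = (SUP s\<in>S. x * s)"
    and Sup_mult: "Sup S * x = (SUP s\<in>S. s * x)"


section \<open>Fuzzy monotonic predicates\<close>

text \<open>Scott continuity into the opposite lattice, in terms of the order of \<open>'l\<close>. The pointwise
  order on predicates is the order of the function type \<open>'d \<Rightarrow> 'l\<close>.\<close>

definition fuzzy_preds :: "('d::dcpo \<Rightarrow> 'l::complete_lattice) set" where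
  "fuzzy_preds = {m. antimono m \<and> (\<forall>C. directed C \<longrightarrow> m (Sup C) = (INF c\<in>C. m c))}"

definition smult :: "'l::unital_quantale \<Rightarrow> ('d::dcpo \<Rightarrow> 'l) \<Rightarrow> 'd \<Rightarrow> 'l"  (infixr \<open>\<odot>\<close> 75) where
  "\<alpha> \<odot> m = (LEAST m'. m' \<in> fuzzy_preds \<and> (\<forall>b. \<alpha> * m b \<le> m' b))"

definition sp ::
  "('d::dcpo \<Rightarrow> 'e::dcpo \<Rightarrow> 'l::unital_quantale) \<Rightarrow> ('d \<Rightarrow> 'l) \<Rightarrow> 'e \<Rightarrow> 'l" where
  "sp \<phi> m = (LEAST m'. m' \<in> fuzzy_preds \<and> (\<forall>a b. m a * \<phi> a b \<le> m' b))"

text \<open>The supremum of \<open>\<phi> ` C\<close> is taken in the poset \<^const>\<open>fuzzy_preds\<close>, where it may be strictly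
  larger than the pointwise supremum.\<close>

definition scott_continuous_preds :: "('d::dcpo \<Rightarrow> 'e::dcpo \<Rightarrow> 'l::complete_lattice) \<Rightarrow> bool" where
  "scott_continuous_preds \<phi> \<longleftrightarrow>
     (\<forall>C. directed C \<longrightarrow> isLub fuzzy_preds (\<phi> ` C) (\<phi> (Sup C)))"

text \<open>Finite joins of predicates are pointwise (see \<open>sup_in_fuzzy_preds\<close> below), so the
  \<open>n\<close>-fold join is a supremum in the function type.\<close>

definition linear_on_preds ::
  "(('d::dcpo \<Rightarrow> 'l::unital_quantale) \<Rightarrow> 'e::dcpo \<Rightarrow> 'l) \<Rightarrow> bool" where
  "linear_on_preds f \<longleftrightarrow>
     (\<forall>m\<in>fuzzy_preds. f m \<in> fuzzy_preds) \<and>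
     (\<forall>n\<ge>1::nat. \<forall>x \<alpha>. (\<forall>i\<in>{1..n}. x i \<in> fuzzy_preds) \<longrightarrow>
        f (SUP i\<in>{1..n}. \<alpha> i \<odot> x i) = (SUP i\<in>{1..n}. \<alpha> i \<odot> f (x i)))"


section \<open>Explicit formulas\<close>

lemma way_below_le:
  fixes a b :: "'d::dcpo"
  assumes "a \<lless> b"
  shows "a \<le> b"
proof -
  have d: "directed {b}" by (simp add: directed_def)
  have "b \<le> Sup {b}" using d by (simp add: directed_Sup_upper)
  then show ?thesis using assms d unfolding way_below_def by blast
qed

lemma way_below_trans_le:
  fixes a b c d :: "'d::dcpo"
  assumes "a \<le> b" "b \<lless> c" "c \<le> d"
  shows "a \<lless> d"
  using assms unfolding way_below_def by (meson order_trans)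

lemma way_below_interpolate:
  fixes a b :: "'d::continuous_domain"
  assumes "a \<lless> b"
  shows "\<exists>c. a \<lless> c \<and> c \<lless> b"
proof -
  define C where "C = {x. \<exists>c. x \<lless> c \<and> c \<lless> b}"
  have ne: "\<exists>x. x \<lless> y" for y :: 'd
    using directed_way_below[of y] by (auto simp: directed_def)
  have ub: "\<exists>z. x \<le> z \<and> y \<le> z \<and> z \<lless> c" if "x \<lless> c" "y \<lless> c" for x y c :: 'd
    using directed_way_below[of c] that unfolding directed_def by blast
  have dir: "directed C"
    unfolding directed_def
  proof (intro conjI ballI)
    show "C \<noteq> {}" using ne unfolding C_def by blast
    fix x y assume "x \<in> C" "y \<in> C"
    then obtain c d where cd: "x \<lless> c" "c \<lless> b" "y \<lless> d" "d \<lless> b"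
      unfolding C_def by blast
    obtain e where e: "c \<le> e" "d \<le> e" "e \<lless> b" using ub cd by blast
    have "x \<lless> e" "y \<lless> e" using cd e way_below_trans_le by blast+
    then obtain z where "x \<le> z" "y \<le> z" "z \<lless> e" using ub by blast
    then show "\<exists>z\<in>C. x \<le> z \<and> y \<le> z" using e unfolding C_def by blast
  qed
  have "c \<le> Sup C" if "c \<lless> b" for c
  proof -
    have "Sup {x. x \<lless> c} \<le> Sup C"
      using that by (intro directed_Sup_least directed_way_below directed_Sup_upper dir)
        (auto simp: C_def)
    then show ?thesis by (simp add: Sup_way_below)
  qed
  then have "Sup {c. c \<lless> b} \<le> Sup C"
    by (intro directed_Sup_least directed_way_below) auto
  then have "b \<le> Sup C" by (simp add: Sup_way_below)
  then obtain x where "x \<in> C" "a \<le> x" using assms dir unfolding way_below_def by blast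
  then show ?thesis unfolding C_def using way_below_trans_le by blast
qed

lemma quantale_mult_mono:
  fixes a b c d :: "'l::unital_quantale"
  assumes "a \<le> b" "c \<le> d"
  shows "a * c \<le> b * d"
proof -
  have "a * c \<le> a * d"
    using mult_Sup[of a "{c, d}"] assms(2) by (simp add: sup.absorb2) (metis sup_ge1)
  also have "\<dots> \<le> b * d"
    using Sup_mult[of "{a, b}" d] assms(1) by (simp add: sup.absorb2) (metis sup_ge1)
  finally show ?thesis .
qed

lemma fuzzy_preds_way_below:
  fixes m :: "'d::continuous_domain \<Rightarrow> 'l::complete_lattice"
  assumes "m \<in> fuzzy_preds"
  shows "m b = (INF a\<in>{a. a \<lless> b}. m a)"
  using assms directed_way_below[of b] Sup_way_below[of b] unfolding fuzzy_preds_def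
  by (metis (mono_tags, lifting) mem_Collect_eq)

lemma least_fuzzy_pred_above:
  fixes g :: "'d::continuous_domain \<Rightarrow> 'l::complete_lattice"
  assumes "antimono g"
  defines "r \<equiv> \<lambda>b. INF a\<in>{a. a \<lless> b}. g a"
  shows "r \<in> fuzzy_preds"
    and "g \<le> r"
    and "(LEAST m'. m' \<in> fuzzy_preds \<and> g \<le> m') = r"
proof -
  have anti: "antimono r"
    unfolding r_def by (intro antimonoI INF_superset_mono) (auto intro: way_below_trans_le)
  have "r (Sup C) = (INF c\<in>C. r c)" if C: "directed C" for C
  proof (rule order.antisym)
    show "r (Sup C) \<le> (INF c\<in>C. r c)"
      by (rule INF_greatest) (rule antimonoD[OF anti directed_Sup_upper[OF C]])
    have "(INF c\<in>C. r c) \<le> g a" if "a \<lless> Sup C" for a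
    proof -
      obtain d where d: "a \<lless> d" "d \<lless> Sup C"
        using way_below_interpolate[OF \<open>a \<lless> Sup C\<close>] by blast
      from d(2) C obtain c where "c \<in> C" "d \<le> c" unfolding way_below_def by blast
      have "a \<lless> c" using way_below_trans_le[OF order_refl d(1) \<open>d \<le> c\<close>] .
      have "(INF c\<in>C. r c) \<le> r c" using \<open>c \<in> C\<close> by (rule INF_lower)
      also have "r c \<le> g a" unfolding r_def using \<open>a \<lless> c\<close> by (intro INF_lower) simp
      finally show ?thesis .
    qed
    then have "(INF c\<in>C. r c) \<le> (INF a\<in>{a. a \<lless> Sup C}. g a)"
      by (intro INF_greatest) simp
    then show "(INF c\<in>C. r c) \<le> r (Sup C)"
      unfolding r_def .
  qed
  with anti show 1: "r \<in> fuzzy_preds" by (simp add: fuzzy_preds_def)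
  show 2: "g \<le> r"
    unfolding r_def
    by (intro le_funI INF_greatest antimonoD[OF assms(1)]) (simp add: way_below_le)
  show "(LEAST m'. m' \<in> fuzzy_preds \<and> g \<le> m') = r"
  proof (rule Least_equality)
    show "r \<in> fuzzy_preds \<and> g \<le> r" using 1 2 by simp
    fix m' assume m': "m' \<in> fuzzy_preds \<and> g \<le> m'"
    show "r \<le> m'"
    proof (rule le_funI)
      fix b
      have "r b \<le> (INF a\<in>{a. a \<lless> b}. m' a)"
        unfolding r_def using m' by (intro INF_mono) (auto simp: le_fun_def)
      also have "\<dots> = m' b" using m' fuzzy_preds_way_below by metis
      finally show "r b \<le> m' b" .
    qed
  qed
qed

lemma smult_explicit:
  fixes m :: "'d::continuous_domain \<Rightarrow> 'l::unital_quantale"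
  assumes "m \<in> fuzzy_preds"
  shows "\<alpha> \<odot> m = (\<lambda>b. INF a\<in>{a. a \<lless> b}. \<alpha> * m a)"
    and "\<alpha> \<odot> m \<in> fuzzy_preds"
    and "\<alpha> * m b \<le> (\<alpha> \<odot> m) b"
proof -
  let ?g = "\<lambda>b. \<alpha> * m b"
  have m: "antimono m" using assms by (simp add: fuzzy_preds_def)
  have g: "antimono ?g"
    by (intro antimonoI quantale_mult_mono order_refl antimonoD[OF m])
  show eq: "\<alpha> \<odot> m = (\<lambda>b. INF a\<in>{a. a \<lless> b}. \<alpha> * m a)"
    using least_fuzzy_pred_above(3)[OF g] by (simp add: smult_def le_fun_def)
  show "\<alpha> \<odot> m \<in> fuzzy_preds" using least_fuzzy_pred_above(1)[OF g] by (simp add: eq)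
  show "\<alpha> * m b \<le> (\<alpha> \<odot> m) b"
    using least_fuzzy_pred_above(2)[OF g] by (simp add: eq le_fun_def)
qed

lemma sp_explicit:
  fixes \<phi> :: "'d::dcpo \<Rightarrow> 'e::continuous_domain \<Rightarrow> 'l::unital_quantale"
  assumes "\<And>a. \<phi> a \<in> fuzzy_preds"
  shows "sp \<phi> m = (\<lambda>b. INF b'\<in>{b'. b' \<lless> b}. SUP a. m a * \<phi> a b')"
    and "sp \<phi> m \<in> fuzzy_preds"
    and "m a * \<phi> a b \<le> sp \<phi> m b"
proof -
  let ?g = "\<lambda>b. SUP a. m a * \<phi> a b"
  have \<phi>: "antimono (\<phi> a)" for a using assms by (simp add: fuzzy_preds_def)
  have g: "antimono ?g"
    by (intro antimonoI SUP_mono' quantale_mult_mono order_refl antimonoD[OF \<phi>])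
  have sp_eq: "(\<forall>a b. m a * \<phi> a b \<le> m' b) \<longleftrightarrow> ?g \<le> m'" for m'
    unfolding le_fun_def SUP_le_iff by blast
  show eq: "sp \<phi> m = (\<lambda>b. INF b'\<in>{b'. b' \<lless> b}. SUP a. m a * \<phi> a b')"
    using least_fuzzy_pred_above(3)[OF g] sp_eq by (simp add: sp_def)
  show "sp \<phi> m \<in> fuzzy_preds" using least_fuzzy_pred_above(1)[OF g] by (simp add: eq)
  have "m a * \<phi> a b \<le> ?g b" by (rule SUP_upper) simp
  also have "\<dots> \<le> sp \<phi> m b"
    using least_fuzzy_pred_above(2)[OF g] by (simp add: eq le_fun_def)
  finally show "m a * \<phi> a b \<le> sp \<phi> m b" .
qed

lemma sup_in_fuzzy_preds:
  fixes m m' :: "'d::dcpo \<Rightarrow> 'l::complete_distrib_lattice"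
  assumes m: "m \<in> fuzzy_preds" and m': "m' \<in> fuzzy_preds"
  shows "sup m m' \<in> fuzzy_preds"
proof -
  have anti: "antimono m" "antimono m'" using m m' by (auto simp: fuzzy_preds_def)
  have "sup m m' (Sup C) = (INF c\<in>C. sup m m' c)" if C: "directed C" for C
  proof -
    have "sup m m' (Sup C) = sup (INF c\<in>C. m c) (INF c\<in>C. m' c)"
      using m m' C by (simp add: fuzzy_preds_def)
    also have "\<dots> = (INF c\<in>C. INF d\<in>C. sup (m c) (m' d))"
      by (simp only: sup_INF INF_sup) (rule INF_commute)
    also have "\<dots> = (INF c\<in>C. sup m m' c)"
    proof (rule order.antisym)
      show "(INF c\<in>C. INF d\<in>C. sup (m c) (m' d)) \<le> (INF c\<in>C. sup m m' c)"
        by (intro INF_greatest) (simp add: INF_lower2)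
      show "(INF c\<in>C. sup m m' c) \<le> (INF c\<in>C. INF d\<in>C. sup (m c) (m' d))"
      proof (intro INF_greatest)
        fix c d assume "c \<in> C" "d \<in> C"
        then obtain e where "e \<in> C" "c \<le> e" "d \<le> e"
          using C unfolding directed_def by blast
        then show "(INF c\<in>C. sup m m' c) \<le> sup (m c) (m' d)"
          by (intro INF_lower2[of e])
            (simp_all add: le_supI1 le_supI2 antimonoD[OF anti(1)] antimonoD[OF anti(2)])
      qed
    qed
    finally show ?thesis .
  qed
  moreover have "antimono (sup m m')"
    by (intro antimonoI) (simp add: le_supI1 le_supI2 antimonoD[OF anti(1)] antimonoD[OF anti(2)])
  ultimately show ?thesis by (simp add: fuzzy_preds_def)
qed

end

theory Submission
  imports Defs
begin

text \<open>
  Both \<^term>\<open>sp \<phi> m\<close> and \<^term>\<open>\<alpha> \<odot> m\<close> are least predicates above a given family of values, so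
  every inequality needed for linearity can be checked on the generating values
  \<^term>\<open>m a * \<phi> a b\<close> and \<^term>\<open>\<alpha> * m b\<close>.

  Preservation of finite joins (\<open>sp_SUP\<close>) then only needs that a finite pointwise join of
  predicates is a predicate, which is where the distributivity of the lattice enters, and that
  \<open>*\<close> distributes over joins on the left.

  In the homogeneity law (\<open>sp_smult\<close>), \<open>\<alpha> \<odot> sp \<phi> m \<le> sp \<phi> (\<alpha> \<odot> m)\<close> holds because moving \<open>\<alpha>\<close> inside
  an infimum can only increase the value, while moving it inside a supremum changes nothing. The
  opposite inequality is the delicate one: it asks for
  \<open>(\<alpha> \<odot> m) a * \<phi> a b \<le> (\<alpha> \<odot> sp \<phi> m) b\<close>,
  and \<open>(\<alpha> \<odot> m) a\<close>, an infimum of the values \<open>\<alpha> * m a'\<close> over \<open>a' \<lless> a\<close>, may be strictly larger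
  than \<open>\<alpha> * m a\<close>. Each of the two alternative hypotheses closes this gap. If \<open>*\<close> distributes over
  infima, the two values coincide. If \<open>\<phi>\<close> is Scott continuous, \<open>\<phi> a b\<close> is for every
  \<open>b' \<lless> b\<close> at most the join of the values \<open>\<phi> a' b'\<close> over \<open>a' \<lless> a\<close> (\<open>scott_continuous_preds_le_SUP\<close>),
  so \<open>a\<close> may be replaced by points \<open>a'\<close> at which \<open>(\<alpha> \<odot> m) a \<le> \<alpha> * m a'\<close>.
\<close>

lemma SUP_in_fuzzy_preds:
  fixes x :: "'i \<Rightarrow> 'd::dcpo \<Rightarrow> 'l::complete_distrib_lattice"
  assumes "finite I" "I \<noteq> {}" "\<And>i. i \<in> I \<Longrightarrow> x i \<in> fuzzy_preds"
  shows "(SUP i\<in>I. x i) \<in> fuzzy_preds"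
  using assms by (induction I rule: finite_ne_induct) (auto intro: sup_in_fuzzy_preds)

lemma way_below_exists: "\<exists>a. a \<lless> (b::'d::continuous_domain)"
  using directed_way_below[of b] by (auto simp: directed_def)

lemma smult_least:
  fixes m m' :: "'d::continuous_domain \<Rightarrow> 'l::unital_quantale"
  assumes "m \<in> fuzzy_preds" "m' \<in> fuzzy_preds" "\<And>b. \<alpha> * m b \<le> m' b"
  shows "\<alpha> \<odot> m \<le> m'"
proof (rule le_funI)
  fix b
  have "(\<alpha> \<odot> m) b \<le> (INF a\<in>{a. a \<lless> b}. m' a)"
    unfolding smult_explicit(1)[OF assms(1)] by (intro INF_mono') (rule assms(3))
  then show "(\<alpha> \<odot> m) b \<le> m' b"
    using fuzzy_preds_way_below[OF assms(2)] by metis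
qed

lemma sp_least:
  fixes \<phi> :: "'d::dcpo \<Rightarrow> 'e::continuous_domain \<Rightarrow> 'l::unital_quantale"
  assumes "\<And>a. \<phi> a \<in> fuzzy_preds" "m' \<in> fuzzy_preds" "\<And>a b. m a * \<phi> a b \<le> m' b"
  shows "sp \<phi> m \<le> m'"
proof (rule le_funI)
  fix b
  have "sp \<phi> m b \<le> (INF b'\<in>{b'. b' \<lless> b}. m' b')"
    unfolding sp_explicit(1)[OF assms(1)] by (intro INF_mono' SUP_least) (rule assms(3))
  then show "sp \<phi> m b \<le> m' b"
    using fuzzy_preds_way_below[OF assms(2)] by metis
qed

lemma sp_mono:
  fixes \<phi> :: "'d::dcpo \<Rightarrow> 'e::continuous_domain \<Rightarrow> 'l::unital_quantale"
  assumes \<phi>: "\<And>a. \<phi> a \<in> fuzzy_preds" and "m \<le> m'"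
  shows "sp \<phi> m \<le> sp \<phi> m'"
proof (rule sp_least[OF \<phi> sp_explicit(2)[OF \<phi>]])
  fix a b
  have "m a * \<phi> a b \<le> m' a * \<phi> a b"
    using assms(2) by (intro quantale_mult_mono order_refl) (simp add: le_fun_def)
  also have "\<dots> \<le> sp \<phi> m' b" by (rule sp_explicit(3)[OF \<phi>])
  finally show "m a * \<phi> a b \<le> sp \<phi> m' b" .
qed

text \<open>A finite join of postconditions is itself a predicate, and it bounds the generating values
  of the postcondition of the join because \<open>*\<close> distributes over joins.\<close>

lemma sp_SUP:
  fixes \<phi> :: "'d::dcpo \<Rightarrow> 'e::continuous_domain
                \<Rightarrow> 'l::{complete_distrib_lattice, unital_quantale}"
  assumes \<phi>: "\<And>a. \<phi> a \<in> fuzzy_preds" and I: "finite I" "I \<noteq> {}"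
  shows "sp \<phi> (SUP i\<in>I. x i) = (SUP i\<in>I. sp \<phi> (x i))"
proof (rule order.antisym)
  show "(SUP i\<in>I. sp \<phi> (x i)) \<le> sp \<phi> (SUP i\<in>I. x i)"
    by (intro SUP_least sp_mono[OF \<phi>] SUP_upper)
  show "sp \<phi> (SUP i\<in>I. x i) \<le> (SUP i\<in>I. sp \<phi> (x i))"
  proof (rule sp_least[OF \<phi> SUP_in_fuzzy_preds[OF I sp_explicit(2)[OF \<phi>]]])
    fix a b
    have "(SUP i\<in>I. x i) a * \<phi> a b = (SUP i\<in>I. x i a * \<phi> a b)"
      by (simp add: Sup_mult image_image)
    also have "\<dots> \<le> (SUP i\<in>I. sp \<phi> (x i) b)"
      by (intro SUP_mono' sp_explicit(3)[OF \<phi>])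
    finally show "(SUP i\<in>I. x i) a * \<phi> a b \<le> (SUP i\<in>I. sp \<phi> (x i)) b"
      by (simp add: image_image)
  qed
qed

text \<open>The pointwise join of the predicates \<^term>\<open>\<phi> a'\<close>, \<^term>\<open>a' \<lless> a\<close>, need not be a predicate.
  The least predicate above it bounds \<^term>\<open>\<phi> a\<close>, and at \<^term>\<open>b\<close> this predicate lies below the
  value of the pointwise join at any \<^term>\<open>b' \<lless> b\<close>.\<close>

lemma scott_continuous_preds_le_SUP:
  fixes \<phi> :: "'d::continuous_domain \<Rightarrow> 'e::continuous_domain \<Rightarrow> 'l::complete_lattice"
  assumes cont: "scott_continuous_preds \<phi>" and \<phi>: "\<And>a. \<phi> a \<in> fuzzy_preds" and "b' \<lless> b"
  shows "\<phi> a b \<le> (SUP a'\<in>{a'. a' \<lless> a}. \<phi> a' b')"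
proof -
  define g where "g = (\<lambda>b. SUP a'\<in>{a'. a' \<lless> a}. \<phi> a' b)"
  define r where "r = (\<lambda>b. INF b'\<in>{b'. b' \<lless> b}. g b')"
  have "antimono (\<phi> a')" for a' using \<phi> by (simp add: fuzzy_preds_def)
  then have "antimono g"
    unfolding g_def by (intro antimonoI SUP_mono') (rule antimonoD)
  then have r: "r \<in> fuzzy_preds" "g \<le> r"
    unfolding r_def by (rule least_fuzzy_pred_above)+
  have "\<phi> a' \<le> r" if "a' \<lless> a" for a'
  proof -
    have "\<phi> a' \<le> g" unfolding g_def using that by (intro le_funI SUP_upper) simp
    then show ?thesis using r(2) by (rule order_trans)
  qed
  then have "isUb fuzzy_preds (\<phi> ` {a'. a' \<lless> a}) r"
    using r(1) by (auto intro: isUbI setleI)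
  moreover have "isLub fuzzy_preds (\<phi> ` {a'. a' \<lless> a}) (\<phi> a)"
    using cont directed_way_below[of a] Sup_way_below[of a]
    unfolding scott_continuous_preds_def by metis
  ultimately have "\<phi> a \<le> r" by (rule isLub_le_isUb[rotated])
  then have "\<phi> a b \<le> r b" by (simp add: le_fun_def)
  also have "\<dots> \<le> g b'" unfolding r_def using \<open>b' \<lless> b\<close> by (intro INF_lower) simp
  finally show ?thesis unfolding g_def .
qed

lemma smult_sp_le_sp_smult:
  fixes \<phi> :: "'d::continuous_domain \<Rightarrow> 'e::continuous_domain \<Rightarrow> 'l::unital_quantale"
  assumes \<phi>: "\<And>a. \<phi> a \<in> fuzzy_preds" and m: "m \<in> fuzzy_preds"
  shows "\<alpha> \<odot> sp \<phi> m \<le> sp \<phi> (\<alpha> \<odot> m)"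
proof (rule smult_least[OF sp_explicit(2)[OF \<phi>] sp_explicit(2)[OF \<phi>]])
  fix b
  have "\<alpha> * sp \<phi> m b \<le> (SUP a. (\<alpha> \<odot> m) a * \<phi> a b')" if "b' \<lless> b" for b'
  proof -
    have "sp \<phi> m b \<le> (SUP a. m a * \<phi> a b')"
      unfolding sp_explicit(1)[OF \<phi>] using that by (intro INF_lower) simp
    then have "\<alpha> * sp \<phi> m b \<le> \<alpha> * (SUP a. m a * \<phi> a b')"
      by (intro quantale_mult_mono order_refl)
    also have "\<dots> = (SUP a. (\<alpha> * m a) * \<phi> a b')"
      by (simp add: mult_Sup image_image mult.assoc)
    also have "\<dots> \<le> (SUP a. (\<alpha> \<odot> m) a * \<phi> a b')"
      by (intro SUP_mono' quantale_mult_mono order_refl smult_explicit(3) m)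
    finally show ?thesis .
  qed
  then show "\<alpha> * sp \<phi> m b \<le> sp \<phi> (\<alpha> \<odot> m) b"
    unfolding sp_explicit(1)[OF \<phi>] by (intro INF_greatest) simp
qed

text \<open>The values \<^term>\<open>\<alpha> * m a * \<phi> a b\<close> are bounded by \<^term>\<open>\<alpha> * sp \<phi> m b\<close>, but the claim
  concerns the possibly larger values \<^term>\<open>(\<alpha> \<odot> m) a * \<phi> a b\<close>. Scott continuity makes up for
  the difference by trading \<^term>\<open>a\<close> for points way below it, distributivity over infima by
  making the difference vanish.\<close>

lemma sp_smult_le_smult_sp:
  fixes \<phi> :: "'d::continuous_domain \<Rightarrow> 'e::continuous_domain \<Rightarrow> 'l::unital_quantale"
  assumes \<phi>: "\<And>a. \<phi> a \<in> fuzzy_preds" and m: "m \<in> fuzzy_preds"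
    and "scott_continuous_preds \<phi> \<or> (\<forall>S. S \<noteq> {} \<longrightarrow> \<alpha> * Inf S = (INF s\<in>S. \<alpha> * s))"
  shows "sp \<phi> (\<alpha> \<odot> m) \<le> \<alpha> \<odot> sp \<phi> m"
proof (rule sp_least[OF \<phi> smult_explicit(2)[OF sp_explicit(2)[OF \<phi>]]])
  fix a b
  have value_le: "\<alpha> * m a * \<phi> a b \<le> \<alpha> * sp \<phi> m b" for a b
    unfolding mult.assoc by (intro quantale_mult_mono order_refl sp_explicit(3)[OF \<phi>])
  show "(\<alpha> \<odot> m) a * \<phi> a b \<le> (\<alpha> \<odot> sp \<phi> m) b"
    using assms(3)
  proof
    assume cont: "scott_continuous_preds \<phi>"
    have "(\<alpha> \<odot> m) a * \<phi> a b \<le> \<alpha> * sp \<phi> m b'" if "b' \<lless> b" for b'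
    proof -
      have "(\<alpha> \<odot> m) a * \<phi> a b \<le> (\<alpha> \<odot> m) a * (SUP a'\<in>{a'. a' \<lless> a}. \<phi> a' b')"
        using scott_continuous_preds_le_SUP[OF cont \<phi> that]
        by (intro quantale_mult_mono order_refl)
      also have "\<dots> = (SUP a'\<in>{a'. a' \<lless> a}. (\<alpha> \<odot> m) a * \<phi> a' b')"
        by (simp add: mult_Sup image_image)
      also have "\<dots> \<le> \<alpha> * sp \<phi> m b'"
      proof (rule SUP_least)
        fix a' assume "a' \<in> {a'. a' \<lless> a}"
        then have "(\<alpha> \<odot> m) a \<le> \<alpha> * m a'"
          unfolding smult_explicit(1)[OF m] by (rule INF_lower)
        then have "(\<alpha> \<odot> m) a * \<phi> a' b' \<le> \<alpha> * m a' * \<phi> a' b'"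
          by (intro quantale_mult_mono order_refl)
        also have "\<dots> \<le> \<alpha> * sp \<phi> m b'" by (rule value_le)
        finally show "(\<alpha> \<odot> m) a * \<phi> a' b' \<le> \<alpha> * sp \<phi> m b'" .
      qed
      finally show ?thesis .
    qed
    then show ?thesis
      unfolding smult_explicit(1)[OF sp_explicit(2)[OF \<phi>]] by (intro INF_greatest) simp
  next
    assume dist: "\<forall>S. S \<noteq> {} \<longrightarrow> \<alpha> * Inf S = (INF s\<in>S. \<alpha> * s)"
    have "\<alpha> * m a = \<alpha> * (INF a'\<in>{a'. a' \<lless> a}. m a')"
      using fuzzy_preds_way_below[OF m] by metis
    also have "\<dots> = (\<alpha> \<odot> m) a"
      using dist[rule_format, of "m ` {a'. a' \<lless> a}"] way_below_exists[of a]
      by (simp add: smult_explicit(1)[OF m] image_image)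
    finally have "(\<alpha> \<odot> m) a * \<phi> a b \<le> \<alpha> * sp \<phi> m b"
      using value_le[of a b] by simp
    also have "\<dots> \<le> (\<alpha> \<odot> sp \<phi> m) b"
      by (rule smult_explicit(3)[OF sp_explicit(2)[OF \<phi>]])
    finally show ?thesis .
  qed
qed

lemma sp_smult:
  fixes \<phi> :: "'d::continuous_domain \<Rightarrow> 'e::continuous_domain \<Rightarrow> 'l::unital_quantale"
  assumes "\<And>a. \<phi> a \<in> fuzzy_preds" "m \<in> fuzzy_preds"
    and "scott_continuous_preds \<phi> \<or> (\<forall>S. S \<noteq> {} \<longrightarrow> \<alpha> * Inf S = (INF s\<in>S. \<alpha> * s))"
  shows "sp \<phi> (\<alpha> \<odot> m) = \<alpha> \<odot> sp \<phi> m"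
  using sp_smult_le_smult_sp[OF assms] smult_sp_le_sp_smult[OF assms(1,2)]
  by (rule order.antisym)

theorem proposition2p6:
  fixes \<phi> :: "'d::continuous_domain \<Rightarrow> 'e::continuous_domain
                \<Rightarrow> 'l::{complete_distrib_lattice, unital_quantale}"
  assumes "\<And>a. \<phi> a \<in> fuzzy_preds"
    and "scott_continuous_preds \<phi> \<or>
         (\<forall>\<alpha>::'l. \<forall>S. S \<noteq> {} \<longrightarrow>
            \<alpha> * Inf S = (INF s\<in>S. \<alpha> * s) \<and> Inf S * \<alpha> = (INF s\<in>S. s * \<alpha>))"
  shows "linear_on_preds (sp \<phi>)"
  unfolding linear_on_preds_def
proof (intro conjI ballI allI impI)
  show "sp \<phi> m \<in> fuzzy_preds" for m by (rule sp_explicit(2)[OF assms(1)])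
  fix n :: nat and x :: "nat \<Rightarrow> 'd \<Rightarrow> 'l" and \<alpha> :: "nat \<Rightarrow> 'l"
  assume n: "1 \<le> n" and x: "\<forall>i\<in>{1..n}. x i \<in> fuzzy_preds"
  have "sp \<phi> (SUP i\<in>{1..n}. \<alpha> i \<odot> x i) = (SUP i\<in>{1..n}. sp \<phi> (\<alpha> i \<odot> x i))"
    using n by (intro sp_SUP assms(1)) auto
  also have "\<dots> = (SUP i\<in>{1..n}. \<alpha> i \<odot> sp \<phi> (x i))"
    using x assms(2) by (intro SUP_cong refl sp_smult assms(1)) auto
  finally show "sp \<phi> (SUP i\<in>{1..n}. \<alpha> i \<odot> x i) = (SUP i\<in>{1..n}. \<alpha> i \<odot> sp \<phi> (x i))" .
qed

end
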